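(* Let $n\ge 1$ be an integer. Suppose that the shifted Lonely Runner Conjecture (sLRC) is true for $n$ runners and that the Lonely Vector Property holds for every natural number $\le n$. Let $v_1,\dots,v_n$ be pairwise distinct positive integers with $\gcd(v_1,\dots,v_n)=1$ and $$\sum_{S\subseteq [n]} v_S > \binom{n+1}{2}^{n-1}.$$ Then sLRC is true for the $n+1$ runners with velocities $0,v_1,\dots,v_n$, that is, for every $s_1,\dots,s_n\in\mathbb{R}$ there is some $t\in\mathbb{R}$ such that $\|v_it+s_i\|\ge\frac{1}{n+1}$ for every $1\le i\le n$.
   Context: For $x\in\mathbb{R}$, $\|x\|$ denotes the distance from $x$ to a nearest integer. "sLRC is true for $m+1$ runners" means: for all pairwise distinct positive real numbers $w_1,\dots,w_m$ and all $s_1,\dots,s_m\in\mathbb{R}$ there is some $t\in\mathbb{R}$ with $\|w_it+s_i\|\ge\frac1{m+1}$ for all $1\le i\le m$ (so "for $n$ runners" is the statement with $n-1$ velocities; for zero velocities it is vacuous). Here $[n]=\{1,\dots,n\}$ and, for $S\subseteq[n]$, $v_S:=\gcd(v_i:i\in S)$, with $v_\emptyset=0$. Lonely Vector Property (LVP): for a set $\mathbf P=\{\mathbf p_1,\dots,\mathbf p_k\}\subseteq\mathbb{R}^2$ of $k$ non-zero vectors, not all parallel and no two equal or opposite to one another, let $S_{\mathbf P}$ be the multiset of cardinality $k^2$ given by $$S_{\mathbf P}=\mathbf P\cup\{\mathbf p_i+\mathbf p_j:1\le i<j\le k\}\cup\{\mathbf p_i-\mathbf p_j:1\le i<j\le k\}.$$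 The set $\mathbf P$ satisfies the LVP if $S_{\mathbf P}$ contains a vector that is not parallel to any other vector in the multiset $S_{\mathbf P}$. The LVP holds for a natural number $k$ if every set of $k$ non-zero vectors in $\mathbb{Q}^2$, not all parallel and no two equal or opposite, satisfies the LVP. *)

theory Defs
  imports "HOL-Analysis.Analysis" "HOL-Library.Multiset"
begin

definition dist_nearest_int :: "real \<Rightarrow> real" where
  "dist_nearest_int x = \<bar>x - of_int (round x)\<bar>"

text \<open>
  One of the \<open>n\<close> runners is stationary; the other \<open>n - 1\<close> are indexed by \<open>{1..<n}\<close>.
\<close>

definition sLRC :: "nat \<Rightarrow> bool" where
  "sLRC n \<longleftrightarrow>
    (\<forall>w s :: nat \<Rightarrow> real.
      (\<forall>i\<in>{1..<n}. 0 < w i) \<longrightarrow> inj_on w {1..<n} \<longrightarrow>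
      (\<exists>t. \<forall>i\<in>{1..<n}. dist_nearest_int (w i * t + s i) \<ge> 1 / real n))"

text \<open>
  Only ever applied to non-zero vectors, for which this is the usual equivalence relation.
\<close>

definition parallel :: "real ^ 2 \<Rightarrow> real ^ 2 \<Rightarrow> bool" where
  "parallel x y \<longleftrightarrow> (\<exists>c. c \<noteq> 0 \<and> y = c *\<^sub>R x)"

text \<open>
  A set of \<open>k\<close> vectors is given by an enumeration \<open>p 1, \<dots>, p k\<close>. A different enumeration
  only changes the signs of some of the differences \<open>p i - p j\<close>.
\<close>

definition lvp_admissible :: "nat \<Rightarrow> (nat \<Rightarrow> real ^ 2) \<Rightarrow> bool" where
  "lvp_admissible k p \<longleftrightarrow>
    (\<forall>i\<in>{1..k}. p i \<noteq> 0) \<and>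
    \<not> (\<forall>i\<in>{1..k}. \<forall>j\<in>{1..k}. parallel (p i) (p j)) \<and>
    (\<forall>i\<in>{1..k}. \<forall>j\<in>{1..k}. i \<noteq> j \<longrightarrow> p i \<noteq> p j \<and> p i \<noteq> - p j)"

definition lvp_mset :: "nat \<Rightarrow> (nat \<Rightarrow> real ^ 2) \<Rightarrow> (real ^ 2) multiset" where
  "lvp_mset k p =
    image_mset p (mset_set {1..k}) +
    image_mset (\<lambda>(i, j). p i + p j) (mset_set {(i, j). 1 \<le> i \<and> i < j \<and> j \<le> k}) +
    image_mset (\<lambda>(i, j). p i - p j) (mset_set {(i, j). 1 \<le> i \<and> i < j \<and> j \<le> k})"

text \<open>
  Removing a single copy of \<open>x\<close> makes a repeated vector count as parallel to another
  member of the multiset.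
\<close>

definition satisfies_LVP :: "nat \<Rightarrow> (nat \<Rightarrow> real ^ 2) \<Rightarrow> bool" where
  "satisfies_LVP k p \<longleftrightarrow>
    (\<exists>x \<in># lvp_mset k p. \<forall>y \<in># lvp_mset k p - {#x#}. \<not> parallel x y)"

definition LVP :: "nat \<Rightarrow> bool" where
  "LVP k \<longleftrightarrow>
    (\<forall>p. lvp_admissible k p \<longrightarrow> (\<forall>i\<in>{1..k}. \<forall>c. p i $ c \<in> \<rat>) \<longrightarrow> satisfies_LVP k p)"

text \<open>The set is finite, so that \<open>mset_set\<close> does not silently return the empty multiset.\<close>

lemma finite_index_pairs: "finite {(i, j). 1 \<le> i \<and> i < j \<and> j \<le> (k::nat)}"
  by (rule finite_subset[of _ "{..k} \<times> {..k}"]) auto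

end

theory Submission
  imports Defs
begin

text \<open>
  Let \<open>K = n (n + 1) / 2\<close>. The number of integer points, taken modulo \<open>\<int> v\<close>, that some multiple of \<open>v\<close>
  translates into the unit cube is the sum of the \<open>Gcd (v ` S)\<close> over nonempty \<open>S\<close>. It exceeds
  \<open>K ^ (n - 1)\<close>, the index of \<open>K \<int>\<^sup>n + \<int> v\<close> in \<open>\<int>\<^sup>n\<close>, so two of these points differ by \<open>K w + m v\<close> with
  \<open>w\<close> not proportional to \<open>v\<close>, whence \<open>w + a v\<close> has all entries at most \<open>1 / K\<close> for some real \<open>a\<close>.
  If runner \<open>i\<close> is given the two-dimensional time \<open>(t, r)\<close> and position \<open>v i t + w i r + s i\<close>, moving
  orthogonally to a lonely vector of the \<open>(v i, w i)\<close> leaves only \<open>n - 1\<close> distinct nonzero speeds,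
  so distance \<open>1 / n\<close> is reached. One may take \<open>r\<close> to be at most \<open>1 / 2\<close> in absolute value; replacing
  \<open>w\<close> by \<open>- a v\<close> then costs at most \<open>1 / (2 K) = 1 / n - 1 / (n + 1)\<close>.
\<close>

section \<open>Distance to the nearest integer: Lipschitz bound, symmetry, periodicity\<close>

lemma dist_nearest_int_le: "dist_nearest_int x \<le> \<bar>x - of_int m\<bar>"
  unfolding dist_nearest_int_def
  using round_diff_minimal[of x m] by (simp add: abs_minus_commute)

lemma dist_nearest_int_triangle: "dist_nearest_int x \<le> dist_nearest_int y + \<bar>x - y\<bar>"
  using dist_nearest_int_le[of x "round y"] unfolding dist_nearest_int_def by linarith

lemma dist_nearest_int_minus [simp]: "dist_nearest_int (- x) = dist_nearest_int x"
proof -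
  have le: "dist_nearest_int (- y) \<le> dist_nearest_int y" for y
    using dist_nearest_int_le[of "- y" "- round y"] unfolding dist_nearest_int_def by simp
  show ?thesis using le[of x] le[of "- x"] by simp
qed

lemma dist_nearest_int_add_of_int [simp]: "dist_nearest_int (x + of_int m) = dist_nearest_int x"
proof -
  have le: "dist_nearest_int (y + of_int k) \<le> dist_nearest_int y" for y k
    using dist_nearest_int_le[of "y + of_int k" "round y + k"]
    unfolding dist_nearest_int_def by simp
  show ?thesis using le[of x m] le[of "x + of_int m" "- m"] by simp
qed

lemma dist_nearest_int_half: "dist_nearest_int (1 / 2) = 1 / 2"
proof -
  have "round (1 / 2 :: real) = 1"
    by (simp add: round_def)
  then show ?thesis by (simp add: dist_nearest_int_def)
qed

section \<open>Simultaneous approximation\<close>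

text \<open>
  With \<open>T = j / Gcd (v ` S)\<close> these are the integer points \<open>x\<close> such that \<open>x - T v\<close> lies in the unit
  cube, \<open>T\<close> is maximal with this property, and \<open>S\<close> is the set of coordinates where \<open>x - T v\<close>
  vanishes.
\<close>

definition cube_point :: "('i \<Rightarrow> nat) \<Rightarrow> 'i set \<Rightarrow> nat \<Rightarrow> 'i \<Rightarrow> nat" where
  "cube_point v S j i = j * v i div Gcd (v ` S) + (if i \<in> S then 0 else 1)"

lemma cube_point_mem:
  assumes "i \<in> S" "Gcd (v ` S) > 0"
  shows "real (cube_point v S j i) = real j / real (Gcd (v ` S)) * real (v i)"
proof -
  have "Gcd (v ` S) dvd j * v i"
    using assms by (intro dvd_mult Gcd_dvd) auto
  then show ?thesis
    using assms by (simp add: cube_point_def real_of_nat_div)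
qed

lemma cube_point_notin:
  assumes "i \<notin> S" "Gcd (v ` S) > 0"
  shows "real j / real (Gcd (v ` S)) * real (v i) < real (cube_point v S j i)"
    and "real (cube_point v S j i) \<le> real j / real (Gcd (v ` S)) * real (v i) + 1"
proof -
  let ?g = "Gcd (v ` S)"
  have "real (j * v i div ?g) \<le> real (j * v i) / real ?g"
    by (rule of_nat_div_le_of_nat)
  then show "real (cube_point v S j i) \<le> real j / real ?g * real (v i) + 1"
    using assms by (simp add: cube_point_def)
  have "j * v i < ?g * (j * v i div ?g + 1)"
    using dividend_less_times_div[OF assms(2), of "j * v i"] by simp
  then have "real (j * v i) < real (?g * (j * v i div ?g + 1))"
    by (simp only: of_nat_less_iff)
  then have "real j * real (v i) < real (cube_point v S j i) * real ?g"
    using assms(1) by (simp only: of_nat_mult cube_point_def if_False mult.commute)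
  then show "real j / real ?g * real (v i) < real (cube_point v S j i)"
    using assms(2) by (simp add: divide_less_eq)
qed

lemma cube_point_bounds:
  assumes "Gcd (v ` S) > 0"
  shows "real j / real (Gcd (v ` S)) * real (v i) \<le> real (cube_point v S j i)"
    and "real (cube_point v S j i) \<le> real j / real (Gcd (v ` S)) * real (v i) + 1"
proof -
  show "real j / real (Gcd (v ` S)) * real (v i) \<le> real (cube_point v S j i)"
    using cube_point_mem[OF _ assms, of i j] cube_point_notin(1)[OF _ assms, of i j]
    by (cases "i \<in> S") (simp_all only: not_False_eq_True order.refl less_imp_le)
  show "real (cube_point v S j i) \<le> real j / real (Gcd (v ` S)) * real (v i) + 1"
    using cube_point_mem[OF _ assms, of i j] cube_point_notin(2)[OF _ assms, of i j]
    by (cases "i \<in> S") simp_all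
qed

text \<open>Since the gcd over the empty set is 0, \<open>S\<close> has an element \<open>i\<close>.
  There the first point equals its height times \<open>v i\<close>, while the second is at least its
  own height times \<open>v i\<close>; comparing the two at \<open>i\<close> gives the
  bound.\<close>

lemma cube_point_height_le:
  fixes q :: int
  assumes "S \<subseteq> I" and j: "j < Gcd (v ` S)" "j' < Gcd (v ` S')"
    and pos: "\<And>i. i \<in> I \<Longrightarrow> v i > 0"
    and eq: "\<And>i. i \<in> I \<Longrightarrow> int (cube_point v S j i) = int (cube_point v S' j' i) + q * int (v i)"
  shows "real j' / real (Gcd (v ` S')) + of_int q \<le> real j / real (Gcd (v ` S))"
proof -
  have "S \<noteq> {}" using j by auto
  then obtain i where i: "i \<in> S" by blast
  then have "i \<in> I" using assms(1) by blast
  have "(real j' / real (Gcd (v ` S')) + of_int q) * real (v i)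
      \<le> real (cube_point v S' j' i) + of_int q * real (v i)"
    using cube_point_bounds(1)[of v S' j' i] j by (simp add: distrib_right)
  also have "\<dots> = real (cube_point v S j i)"
    using arg_cong[OF eq[OF \<open>i \<in> I\<close>], of real_of_int] by simp
  also have "\<dots> = real j / real (Gcd (v ` S)) * real (v i)"
    using cube_point_mem[OF i] j by simp
  finally show ?thesis
    using pos[OF \<open>i \<in> I\<close>] by (simp only: mult_le_cancel_right_pos of_nat_0_less_iff)
qed

text \<open>Comparing in both directions, the heights differ by exactly \<open>q\<close>; both lie
  in [0, 1), so \<open>q = 0\<close>. The common point and height then determine first the set and
  then \<open>j\<close>.\<close>

lemma cube_point_inj_mod:
  fixes q :: int
  assumes "S \<subseteq> I" "S' \<subseteq> I" and j: "j < Gcd (v ` S)" "j' < Gcd (v ` S')"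
    and pos: "\<And>i. i \<in> I \<Longrightarrow> v i > 0"
    and eq: "\<And>i. i \<in> I \<Longrightarrow> int (cube_point v S j i) = int (cube_point v S' j' i) + q * int (v i)"
  shows "S = S'" "j = j'" "q = 0"
proof -
  let ?T = "real j / real (Gcd (v ` S))" and ?T' = "real j' / real (Gcd (v ` S'))"
  have "?T' + of_int q \<le> ?T"
    using cube_point_height_le[OF assms(1) j pos eq] .
  moreover have "?T + of_int (- q) \<le> ?T'"
    by (rule cube_point_height_le[OF assms(2) j(2,1) pos]) (use eq in auto)
  ultimately have T: "?T = ?T' + of_int q" by simp
  have "0 \<le> ?T" "?T < 1" "0 \<le> ?T'" "?T' < 1"
    using j by (auto simp: divide_less_eq)
  then have "\<bar>real_of_int q\<bar> < 1" using T by linarith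
  then show q: "q = 0" by linarith
  \<comment> \<open>Outside \<open>S''\<close> the point lies strictly above height times
    \<open>v i\<close>, so equality singles out \<open>S''\<close>.\<close>
  have char: "S'' = {i \<in> I. real (cube_point v S'' j'' i) = real j'' / real (Gcd (v ` S'')) * real (v i)}"
    if "S'' \<subseteq> I" "j'' < Gcd (v ` S'')" for S'' j''
  proof -
    have "Gcd (v ` S'') > 0" using that by auto
    then show ?thesis
      using that cube_point_mem[of _ S'' v j''] cube_point_notin(1)[of _ S'' v j''] by force
  qed
  show S: "S = S'"
  proof (subst char[OF assms(1) j(1)], subst char[OF assms(2) j(2)], intro Collect_cong conj_cong refl)
    fix i assume "i \<in> I"
    then have "cube_point v S j i = cube_point v S' j' i" using eq q by fastforce
    moreover have "?T = ?T'" using T q by simp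
    ultimately show "(real (cube_point v S j i) = ?T * real (v i)) \<longleftrightarrow>
        (real (cube_point v S' j' i) = ?T' * real (v i))"
      by metis
  qed
  have "Gcd (v ` S') > 0" using j by linarith
  then show "j = j'" using T q unfolding S by (simp del: Gcd_0_iff)
qed

text \<open>The denominator of \<open>c\<close> in lowest terms divides every \<open>v i\<close>,
  hence their gcd.\<close>

lemma rational_multiplier_int:
  fixes c :: real
  assumes "Gcd (v ` I) = (1 :: nat)" "i0 \<in> I" "v i0 > 0"
    and w: "\<And>i. i \<in> I \<Longrightarrow> of_int (w i) = c * real (v i)"
  shows "\<exists>q :: int. c = of_int q"
proof -
  have "c = of_int (w i0) / of_int (int (v i0))"
    using w[OF assms(2)] assms(3) by (simp add: field_simps)
  then have "c \<in> \<rat>" by simp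
  then obtain a b :: int where ab: "b > 0" "coprime a b" "c = of_int a / of_int b"
    by (rule Rats_cases')
  have "nat b dvd v i" if "i \<in> I" for i
  proof -
    have "real_of_int (b * w i) = real_of_int (a * int (v i))"
      using w[OF that] ab by (simp add: field_simps)
    then have "b * w i = a * int (v i)" by linarith
    then have "b dvd a * int (v i)" by (metis dvd_triv_left)
    then have "b dvd int (v i)"
      using ab(2) coprime_commute coprime_dvd_mult_right_iff by blast
    then show ?thesis using ab(1) by (simp add: nat_dvd_iff)
  qed
  then have "nat b dvd Gcd (v ` I)" by (auto intro: Gcd_greatest)
  then have "b = 1" using assms(1) ab(1) by simp
  then show ?thesis using ab(3) by auto
qed

lemma simultaneous_approximation:
  fixes v :: "'i \<Rightarrow> nat" and K :: nat
  assumes fin: "finite I" and ne: "I \<noteq> {}" and pos: "\<And>i. i \<in> I \<Longrightarrow> v i > 0"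
    and gcd: "Gcd (v ` I) = 1" and K: "K > 0"
    and large: "K ^ (card I - 1) < (\<Sum>S\<in>Pow I. Gcd (v ` S))"
  obtains w :: "'i \<Rightarrow> int" and a :: real
  where "\<forall>i\<in>I. \<bar>of_int (w i) + a * real (v i)\<bar> \<le> 1 / real K"
    and "\<nexists>c :: real. \<forall>i\<in>I. of_int (w i) = c * real (v i)"
proof -
  \<comment> \<open>The empty \<open>S\<close> contributes nothing, its gcd being 0. Translating
    each cube point by \<open>m v\<close> for all \<open>m < K\<close> gives \<open>K\<close> times
    as many points, to be distributed over \<open>K ^ card I\<close> residue vectors modulo
    \<open>K\<close>.\<close>
  define D where "D = (SIGMA S:Pow I. {..<Gcd (v ` S)}) \<times> {..<K}"
  define f where "f = (\<lambda>((S, j), m). \<lambda>i\<in>I. (cube_point v S j i + m * v i) mod K)"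
  have "card D = (\<Sum>S\<in>Pow I. Gcd (v ` S)) * K"
    using fin by (simp add: D_def card_cartesian_product card_SigmaI)
  moreover have "card (I \<rightarrow>\<^sub>E {..<K}) = K ^ (card I - 1) * K"
    using fin ne by (simp add: card_PiE power_minus_mult card_gt_0_iff del: One_nat_def)
  ultimately have "card (I \<rightarrow>\<^sub>E {..<K}) < card D"
    using large K by simp
  moreover have "f ` D \<subseteq> I \<rightarrow>\<^sub>E {..<K}"
    using K by (auto simp: f_def)
  then have "card (f ` D) \<le> card (I \<rightarrow>\<^sub>E {..<K})"
    using fin by (intro card_mono finite_PiE) auto
  ultimately have "\<not> inj_on f D"
    using pigeonhole by (metis order.strict_trans1)
  then obtain S j m S' j' m' where
    D: "((S, j), m) \<in> D" "((S', j'), m') \<in> D" and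
    neq: "((S, j), m) \<noteq> ((S', j'), m')" and feq: "f ((S, j), m) = f ((S', j'), m')"
    unfolding inj_on_def by (metis prod.exhaust_sel)
  have sub: "S \<subseteq> I" "S' \<subseteq> I" and j: "j < Gcd (v ` S)" "j' < Gcd (v ` S')"
    and m: "m < K" "m' < K"
    using D by (auto simp: D_def)
  let ?x = "cube_point v S j" and ?x' = "cube_point v S' j'"
  let ?T = "real j / real (Gcd (v ` S))" and ?T' = "real j' / real (Gcd (v ` S'))"
  \<comment> \<open>The division is exact, because the two translated points agree modulo
    \<open>K\<close>.\<close>
  define w where "w i = (int (?x i) - int (?x' i) + (int m - int m') * int (v i)) div int K" for i
  have w: "int K * w i = int (?x i) - int (?x' i) + (int m - int m') * int (v i)" if "i \<in> I" for i
  proof -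
    have "(?x i + m * v i) mod K = (?x' i + m' * v i) mod K"
      using fun_cong[OF feq, of i] that by (simp add: f_def)
    then have "int K dvd int (?x i + m * v i) - int (?x' i + m' * v i)"
      by (metis mod_eq_dvd_iff zmod_int)
    then show ?thesis by (simp add: w_def algebra_simps)
  qed
  \<comment> \<open>Makes \<open>K (w + a v)\<close> a difference of two points of the unit
    cube.\<close>
  define a where "a = - (?T - ?T' + real m - real m') / real K"
  show thesis
  proof (rule that[of w a], intro ballI)
    fix i assume i: "i \<in> I"
    have "real K * a = - (?T - ?T' + real m - real m')" using K by (simp add: a_def)
    then have "real K * (of_int (w i) + a * real (v i))
        = real K * of_int (w i) + - (?T - ?T' + real m - real m') * real (v i)"
      by (simp only: distrib_left mult.assoc[symmetric])
    also have "\<dots> = (real (?x i) - ?T * real (v i)) - (real (?x' i) - ?T' * real (v i))"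
      using arg_cong[OF w[OF i], of real_of_int] by (simp add: algebra_simps)
    finally have "real K * (of_int (w i) + a * real (v i))
        = (real (?x i) - ?T * real (v i)) - (real (?x' i) - ?T' * real (v i))" .
    moreover have "\<bar>(real (?x i) - ?T * real (v i)) - (real (?x' i) - ?T' * real (v i))\<bar> \<le> 1"
      using cube_point_bounds[of v S j i] cube_point_bounds[of v S' j' i] j by linarith
    ultimately have "real K * \<bar>of_int (w i) + a * real (v i)\<bar> \<le> 1"
      by (metis abs_mult abs_of_nat)
    then show "\<bar>of_int (w i) + a * real (v i)\<bar> \<le> 1 / real K"
      using K by (simp add: field_simps)
  next
    show "\<nexists>c :: real. \<forall>i\<in>I. of_int (w i) = c * real (v i)"
    proof
      assume "\<exists>c :: real. \<forall>i\<in>I. of_int (w i) = c * real (v i)"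
      then obtain c :: real where c: "\<And>i. i \<in> I \<Longrightarrow> of_int (w i) = c * real (v i)" by blast
      obtain i0 where i0: "i0 \<in> I" using ne by blast
      obtain q :: int where q: "c = of_int q"
        using rational_multiplier_int[OF gcd i0 pos[OF i0] c] by blast
      have wq: "w i = q * int (v i)" if "i \<in> I" for i
      proof -
        have "real_of_int (w i) = real_of_int (q * int (v i))" using c[OF that] q by simp
        then show ?thesis by linarith
      qed
      \<comment> \<open>If \<open>w = q v\<close>, the two cube points differ by an integer multiple
        of \<open>v\<close> and so must coincide.\<close>
      have eq: "int (?x i) = int (?x' i) + (int K * q - (int m - int m')) * int (v i)"
        if "i \<in> I" for i
        using w[OF that] wq[OF that] by (simp add: algebra_simps)
      note inj = cube_point_inj_mod[OF sub j pos eq]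
      have "int m - int m' = int K * q" using inj(3) by simp
      moreover have "\<bar>int m - int m'\<bar> < int K" using m by linarith
      ultimately have "\<bar>q\<bar> < 1" using K by (simp add: abs_mult)
      then have "m = m'" using \<open>int m - int m' = int K * q\<close> by simp
      then show False using inj(1,2) neq by simp
    qed
  qed
qed

section \<open>Runners with two-dimensional time\<close>

text \<open>Reflecting the runners of negative speed negates both \<open>u i\<close> and
  \<open>s i\<close> and preserves distances to the integers, so only the absolute speeds need to be
  distinct.\<close>

lemma sLRC_indexed:
  fixes u s :: "'i \<Rightarrow> real"
  assumes "sLRC n" "finite A" "card A = n - 1" "n \<ge> 1"
    and nz: "\<And>i. i \<in> A \<Longrightarrow> u i \<noteq> 0" and inj: "inj_on (\<lambda>i. \<bar>u i\<bar>) A"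
  shows "\<exists>t. \<forall>i\<in>A. dist_nearest_int (u i * t + s i) \<ge> 1 / real n"
proof -
  have "card {1..<n} = card A" using assms(3) by simp
  then obtain h where h: "bij_betw h {1..<n} A"
    using assms(2) finite_same_card_bij by blast
  let ?e = "\<lambda>i. sgn (u i)"
  have "inj_on (\<lambda>k. \<bar>u (h k)\<bar>) {1..<n}"
    using comp_inj_on[of h "{1..<n}" "\<lambda>i. \<bar>u i\<bar>"] h inj by (simp add: bij_betw_def comp_def)
  moreover have "\<forall>k\<in>{1..<n}. 0 < \<bar>u (h k)\<bar>"
    using h nz by (auto simp: bij_betw_def)
  ultimately obtain t where t: "\<And>k. k \<in> {1..<n} \<Longrightarrow>
      dist_nearest_int (\<bar>u (h k)\<bar> * t + ?e (h k) * s (h k)) \<ge> 1 / real n"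
    using assms(1)[unfolded sLRC_def, rule_format,
        of "\<lambda>k. \<bar>u (h k)\<bar>" "\<lambda>k. ?e (h k) * s (h k)"] by blast
  have "dist_nearest_int (u i * t + s i) \<ge> 1 / real n" if "i \<in> A" for i
  proof -
    have "i \<in> h ` {1..<n}"
      using bij_betw_imp_surj_on[OF h] that by simp
    then obtain k where k: "k \<in> {1..<n}" "h k = i" by (elim imageE) simp
    have "\<bar>u i\<bar> * t + ?e i * s i = u i * t + s i \<or> \<bar>u i\<bar> * t + ?e i * s i = - (u i * t + s i)"
      using nz[OF that] by (cases "u i > 0") simp_all
    then have "dist_nearest_int (\<bar>u i\<bar> * t + ?e i * s i) = dist_nearest_int (u i * t + s i)"
      by (elim disjE) (simp_all only: dist_nearest_int_minus)
    then show ?thesis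
      using t[OF k(1)] unfolding k(2) by simp
  qed
  then show ?thesis by blast
qed

section \<open>Indexing the multiset of the Lonely Vector Property\<close>

lemma image_mset_remove_index:
  assumes "finite I" "k \<in> I" "l \<in> I" "l \<noteq> k"
  shows "f l \<in># image_mset f (mset_set I) - {#f k#}"
proof -
  have "mset_set I = add_mset k (mset_set (I - {k}))"
    using assms by (metis mset_set.remove)
  then show ?thesis using assms by simp
qed

text \<open>
  The vector \<open>p i + e p j\<close> of the LVP multiset is indexed by \<open>(i, j, e)\<close>, with \<open>j = 0\<close>, \<open>e = 0\<close>
  for \<open>p i\<close> itself.
\<close>

definition lvp_index :: "nat \<Rightarrow> (nat \<times> nat \<times> real) set" where
  "lvp_index k = (\<lambda>i. (i, 0, 0)) ` {1..k} \<union>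
    (\<lambda>(i, j). (i, j, 1)) ` {(i, j). 1 \<le> i \<and> i < j \<and> j \<le> k} \<union>
    (\<lambda>(i, j). (i, j, - 1)) ` {(i, j). 1 \<le> i \<and> i < j \<and> j \<le> k}"

text \<open>Polymorphic, so that the same combinations can be formed of plane vectors, speeds and
  starting positions.\<close>

definition lvp_vec :: "(nat \<Rightarrow> 'a::real_vector) \<Rightarrow> nat \<times> nat \<times> real \<Rightarrow> 'a" where
  "lvp_vec p = (\<lambda>(i, j, e). p i + e *\<^sub>R p j)"

lemma finite_lvp_index: "finite (lvp_index k)"
  by (simp add: lvp_index_def finite_index_pairs del: One_nat_def)

text \<open>The third component of the index keeps the three families disjoint, so multiplicities
  add up even when vectors coincide.\<close>

lemma lvp_mset_eq: "lvp_mset k p = image_mset (lvp_vec p) (mset_set (lvp_index k))"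
proof -
  let ?P = "{(i, j). 1 \<le> i \<and> i < j \<and> j \<le> k}"
  let ?a = "\<lambda>i::nat. (i, 0::nat, 0::real)"
    and ?b = "\<lambda>(i::nat, j::nat). (i, j, 1::real)" and ?c = "\<lambda>(i::nat, j::nat). (i, j, - 1::real)"
  have inj: "inj_on ?a {1..k}" "inj_on ?b ?P" "inj_on ?c ?P"
    by (auto simp: inj_on_def)
  have "mset_set (lvp_index k) =
      mset_set (?a ` {1..k}) + mset_set (?b ` ?P) + mset_set (?c ` ?P)"
    unfolding lvp_index_def
    by (subst mset_set_Union; (simp add: finite_index_pairs del: One_nat_def)?; force?)+
  also have "\<dots> = image_mset ?a (mset_set {1..k}) + image_mset ?b (mset_set ?P)
      + image_mset ?c (mset_set ?P)"
    using inj by (simp add: image_mset_mset_set)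
  finally show ?thesis
    by (simp add: lvp_mset_def lvp_vec_def image_mset.compositionality comp_def case_prod_unfold)
qed

text \<open>A vector at another index survives the removal of one copy, even if it equals the
  removed one.\<close>

lemma satisfies_LVP_index:
  assumes "satisfies_LVP k p"
  obtains x where "x \<in> lvp_index k"
    and "\<And>y. y \<in> lvp_index k \<Longrightarrow> y \<noteq> x \<Longrightarrow> \<not> parallel (lvp_vec p x) (lvp_vec p y)"
proof -
  obtain z where z: "z \<in># lvp_mset k p" "\<forall>y \<in># lvp_mset k p - {#z#}. \<not> parallel z y"
    using assms unfolding satisfies_LVP_def by blast
  obtain x where x: "x \<in> lvp_index k" "z = lvp_vec p x"
    using z(1) by (auto simp: lvp_mset_eq finite_lvp_index)
  show thesis
    using that[OF x(1)] z(2) x image_mset_remove_index[OF finite_lvp_index x(1)]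
    unfolding lvp_mset_eq by blast
qed

text \<open>\<open>sLRC n\<close> controls only \<open>n - 1\<close> moving runners. Moving
  orthogonally to a lonely vector frees the remaining one: it stands still or mirrors or accompanies
  another runner.\<close>

lemma lonely_planar_time:
  fixes v w s :: "nat \<Rightarrow> real"
  assumes "sLRC n" "LVP n"
    and pos: "\<And>i. i \<in> {1..n} \<Longrightarrow> v i > 0" and inj: "inj_on v {1..n}"
    and rat: "\<And>i. i \<in> {1..n} \<Longrightarrow> v i \<in> \<rat>" "\<And>i. i \<in> {1..n} \<Longrightarrow> w i \<in> \<rat>"
    and nonprop: "\<nexists>c. \<forall>i\<in>{1..n}. w i = c * v i"
  shows "\<exists>t r. \<forall>i\<in>{1..n}. dist_nearest_int (v i * t + w i * r + s i) \<ge> 1 / real n"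
proof -
  have "n \<ge> 2"
  proof (rule ccontr)
    assume "\<not> n \<ge> 2"
    then have "{1..n} \<subseteq> {1}" by auto
    then have "\<forall>i\<in>{1..n}. w i = w 1 / v 1 * v i" using pos by fastforce
    then show False using nonprop by blast
  qed
  define p :: "nat \<Rightarrow> real ^ 2" where "p i = vector [v i, w i]" for i
  have p [simp]: "p i $ 1 = v i" "p i $ 2 = w i" for i by (simp_all add: p_def)
  have "lvp_admissible n p"
    unfolding lvp_admissible_def
  proof (intro conjI ballI impI notI)
    fix i assume "i \<in> {1..n}" "p i = 0"
    then show False using pos p(1)[of i] by fastforce
  next
    fix i j assume ij: "i \<in> {1..n}" "j \<in> {1..n}" "i \<noteq> j" "p i = p j"
    then have "v i = v j" using p(1) by metis
    then show False using ij inj by (auto dest: inj_onD)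
  next
    fix i j assume ij: "i \<in> {1..n}" "j \<in> {1..n}" "i \<noteq> j" "p i = - p j"
    then have "v i = - v j" using p(1) by (metis vector_uminus_component)
    then show False using pos[OF ij(1)] pos[OF ij(2)] by simp
  next
    assume all: "\<forall>i\<in>{1..n}. \<forall>j\<in>{1..n}. parallel (p i) (p j)"
    have "w i = w 1 / v 1 * v i" if "i \<in> {1..n}" for i
    proof -
      have "(1::nat) \<in> {1..n}" using that by simp
      then have "parallel (p 1) (p i)" using all that by blast
      then obtain c where c: "p i = c *\<^sub>R p 1" unfolding parallel_def by blast
      have "v i = c * v 1" "w i = c * w 1"
        using arg_cong[OF c, of "\<lambda>x. x $ 1"] arg_cong[OF c, of "\<lambda>x. x $ 2"] by simp_all
      then show ?thesis using pos[OF \<open>1 \<in> {1..n}\<close>] by simp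
    qed
    then show False using nonprop by blast
  qed
  moreover have "\<forall>i\<in>{1..n}. \<forall>c. p i $ c \<in> \<rat>"
    using rat by (simp add: forall_2)
  ultimately have "satisfies_LVP n p" using assms(2) unfolding LVP_def by blast
  then obtain x where x: "x \<in> lvp_index n"
    and lonely: "\<And>y. y \<in> lvp_index n \<Longrightarrow> y \<noteq> x \<Longrightarrow> \<not> parallel (lvp_vec p x) (lvp_vec p y)"
    by (rule satisfies_LVP_index) blast
  \<comment> \<open>The first coordinates of all vectors in the multiset are nonzero, as the
    \<open>v i\<close> are positive and distinct; this allows division by them below.\<close>
  have nonzero: "lvp_vec v y \<noteq> 0" if "y \<in> lvp_index n" for y
  proof -
    have "v i + v j \<noteq> 0" "v i \<noteq> v j" "v i \<noteq> 0" if "1 \<le> i" "i < j" "j \<le> n" for i j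
      using that pos[of i] pos[of j] inj by (auto dest: inj_onD)
    moreover have "v i \<noteq> 0" if "1 \<le> i" "i \<le> n" for i using that pos[of i] by simp
    ultimately show ?thesis using that by (auto simp: lvp_index_def lvp_vec_def)
  qed
  have comp: "lvp_vec p y $ 1 = lvp_vec v y" "lvp_vec p y $ 2 = lvp_vec w y" for y
    by (simp_all add: lvp_vec_def case_prod_unfold)
  \<comment> \<open>The direction (\<open>\<alpha>\<close>, \<open>\<beta>\<close>) is orthogonal to
    the lonely vector; \<open>u\<close> collects the speeds along it.\<close>
  define \<alpha> \<beta> where "\<alpha> = - lvp_vec w x" and "\<beta> = lvp_vec v x"
  define u where "u i = \<alpha> * v i + \<beta> * w i" for i
  have u_vec: "lvp_vec u y = \<alpha> * lvp_vec v y + \<beta> * lvp_vec w y" for y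
    by (simp add: lvp_vec_def u_def case_prod_unfold algebra_simps)
  have ux: "lvp_vec u x = 0" by (simp add: u_vec \<alpha>_def \<beta>_def)
  \<comment> \<open>In the plane, another vector orthogonal to this direction would be parallel to
    the lonely one.\<close>
  have uy: "lvp_vec u y \<noteq> 0" if "y \<in> lvp_index n" "y \<noteq> x" for y
  proof
    assume "lvp_vec u y = 0"
    then have eq: "lvp_vec v x * lvp_vec w y = lvp_vec w x * lvp_vec v y"
      by (simp add: u_vec \<alpha>_def \<beta>_def)
    let ?c = "lvp_vec v y / lvp_vec v x"
    have "lvp_vec p y = ?c *\<^sub>R lvp_vec p x"
      using eq nonzero[OF x] by (simp add: vec_eq_iff forall_2 comp field_simps)
    moreover have "?c \<noteq> 0" using nonzero that x by simp
    ultimately show False using lonely[OF that] unfolding parallel_def by blast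
  qed
  obtain i j e where xe: "x = (i, j, e)" using prod_cases3 by blast
  have i: "i \<in> {1..n}" using x by (auto simp: xe lvp_index_def)
  let ?A = "{1..n} - {i}"
  have nz: "u k \<noteq> 0" if "k \<in> ?A" for k
  proof -
    have "(k, 0, 0) \<in> lvp_index n" using that by (auto simp: lvp_index_def)
    then show ?thesis using uy[of "(k, 0, 0)"] that by (auto simp: xe lvp_vec_def)
  qed
  \<comment> \<open>Equal absolute speeds would make \<open>u k + u l\<close> or
    \<open>u k - u l\<close> vanish, at an index other than \<open>x\<close> because its first entry
    is not \<open>i\<close>.\<close>
  have neq: "\<bar>u k\<bar> \<noteq> \<bar>u l\<bar>" if "k \<in> ?A" "l \<in> ?A" "k < l" for k l
  proof -
    have "(k, l, 1) \<in> lvp_index n" "(k, l, - 1) \<in> lvp_index n"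
      using that by (auto simp: lvp_index_def)
    then show ?thesis
      using uy[of "(k, l, 1)"] uy[of "(k, l, - 1)"] that
      by (auto simp: xe lvp_vec_def abs_eq_iff add_eq_0_iff2)
  qed
  have inj_abs: "inj_on (\<lambda>k. \<bar>u k\<bar>) ?A"
    using neq by (intro linorder_inj_onI') auto
  have cardA: "card ?A = n - 1" using i by simp
  \<comment> \<open>The starting time is chosen so that, from then on, runner \<open>i\<close> either stays at \<open>1/2\<close> or is at
    the position of runner \<open>j\<close> up to sign.\<close>
  define t0 where "t0 = ((if e = 0 then 1 / 2 else 0) - lvp_vec s x) / lvp_vec v x"
  define s' where "s' k = v k * t0 + s k" for k
  have s'x: "lvp_vec s' x = (if e = 0 then 1 / 2 else 0)"
  proof -
    have "lvp_vec s' x = lvp_vec v x * t0 + lvp_vec s x"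
      by (simp add: lvp_vec_def s'_def case_prod_unfold algebra_simps)
    also have "\<dots> = (if e = 0 then 1 / 2 else 0)"
      using nonzero[OF x] by (simp add: t0_def)
    finally show ?thesis .
  qed
  have "finite ?A" "n \<ge> 1" using \<open>n \<ge> 2\<close> by simp_all
  then obtain t where t: "\<And>k. k \<in> ?A \<Longrightarrow> dist_nearest_int (u k * t + s' k) \<ge> 1 / real n"
    using sLRC_indexed[OF assms(1) _ cardA _ nz inj_abs, of s'] by blast
  have ti: "dist_nearest_int (u i * t + s' i) \<ge> 1 / real n"
  proof (cases "e = 0")
    case True
    then have "u i * t + s' i = 1 / 2" using ux s'x by (simp add: xe lvp_vec_def)
    then show ?thesis using \<open>n \<ge> 2\<close> by (simp only: dist_nearest_int_half) simp
  next
    case False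
    then have j: "j \<in> ?A" and e: "e = 1 \<or> e = - 1" using x by (auto simp: xe lvp_index_def)
    have "u i = - e * u j" "s' i = - e * s' j"
      using ux s'x False by (auto simp: xe lvp_vec_def)
    then have "u i * t + s' i = - e * (u j * t + s' j)" by (simp add: algebra_simps)
    then show ?thesis
      using t[OF j] e dist_nearest_int_minus[of "u j * t + s' j"] by auto
  qed
  \<comment> \<open>The planar times visited form the line through (\<open>t0\<close>, 0) in
    direction (\<open>\<alpha>\<close>, \<open>\<beta>\<close>).\<close>
  have "dist_nearest_int (v k * (\<alpha> * t + t0) + w k * (\<beta> * t) + s k) \<ge> 1 / real n"
    if "k \<in> {1..n}" for k
  proof -
    have "v k * (\<alpha> * t + t0) + w k * (\<beta> * t) + s k = u k * t + s' k"
      by (simp add: u_def s'_def algebra_simps)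
    then show ?thesis using t[of k] ti that by (cases "k = i") auto
  qed
  then show ?thesis by blast
qed

section \<open>From two-dimensional back to one-dimensional time\<close>

theorem theorem2:
  fixes n :: nat and v :: "nat \<Rightarrow> nat"
  assumes "n \<ge> 1"
    and "sLRC n"
    and "\<forall>k\<le>n. LVP k"
    and "\<forall>i\<in>{1..n}. v i > 0"
    and "inj_on v {1..n}"
    and "Gcd (v ` {1..n}) = 1"
    and "(\<Sum>S\<in>Pow {1..n}. Gcd (v ` S)) > ((n + 1) choose 2) ^ (n - 1)"
  shows "\<forall>s :: nat \<Rightarrow> real. \<exists>t :: real.
    \<forall>i\<in>{1..n}. dist_nearest_int (real (v i) * t + s i) \<ge> 1 / real (n + 1)"
proof
  fix s :: "nat \<Rightarrow> real"
  let ?K = "(n + 1) choose 2"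
  have "2 * ?K = n * (n + 1)"
    by (simp add: choose_two)
  then have "real (2 * ?K) = real (n * (n + 1))" by presburger
  then have K: "2 * real ?K = real n * real (n + 1)" by (simp only: of_nat_mult of_nat_numeral)
  have Kpos: "?K > 0" using \<open>n \<ge> 1\<close> by (simp add: zero_less_binomial_iff)
  have ne: "{1..n} \<noteq> {}" using \<open>n \<ge> 1\<close> by simp
  have pos: "v i > 0" if "i \<in> {1..n}" for i using assms(4) that by blast
  have large: "?K ^ (card {1..n} - 1) < (\<Sum>S\<in>Pow {1..n}. Gcd (v ` S))"
    using assms(7) by (simp only: card_atLeastAtMost diff_Suc_1)
  obtain w :: "nat \<Rightarrow> int" and a :: real
    where close: "\<forall>i\<in>{1..n}. \<bar>of_int (w i) + a * real (v i)\<bar> \<le> 1 / real ?K"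
      and nonprop: "\<nexists>c :: real. \<forall>i\<in>{1..n}. of_int (w i) = c * real (v i)"
    by (rule simultaneous_approximation[OF finite_atLeastAtMost ne pos assms(6) Kpos large]) (assumption | rule that)+
  have "\<exists>t r. \<forall>i\<in>{1..n}.
      dist_nearest_int (real (v i) * t + of_int (w i) * r + s i) \<ge> 1 / real n"
  proof (rule lonely_planar_time[OF assms(2)])
    show "LVP n" using assms(3) by blast
    show "inj_on (\<lambda>i. real (v i)) {1..n}"
      by (rule inj_onI) (use inj_onD[OF assms(5)] in simp)
    show "\<nexists>c. \<forall>i\<in>{1..n}. real_of_int (w i) = c * real (v i)" by (rule nonprop)
  qed (use pos in simp_all)
  then obtain t r where tr: "\<And>i. i \<in> {1..n} \<Longrightarrow>
      dist_nearest_int (real (v i) * t + of_int (w i) * r + s i) \<ge> 1 / real n"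
    by blast
  \<comment> \<open>As the \<open>w i\<close> are integers, subtracting \<open>round r\<close>
    shifts every position by an integer.\<close>
  define r' where "r' = r - of_int (round r)"
  have r': "\<bar>r'\<bar> \<le> 1 / 2"
    using of_int_round_abs_le[of r] by (simp add: r'_def abs_minus_commute)
  have "dist_nearest_int (real (v i) * (t - a * r') + s i) \<ge> 1 / real (n + 1)" if i: "i \<in> {1..n}" for i
  proof -
    let ?x = "real (v i) * t + of_int (w i) * r' + s i" and ?y = "real (v i) * (t - a * r') + s i"
    have "real (v i) * t + of_int (w i) * r + s i = ?x + of_int (w i * round r)"
      by (simp add: r'_def algebra_simps)
    then have "1 / real n \<le> dist_nearest_int ?x"
      using tr[OF i] by (metis dist_nearest_int_add_of_int)
    also have "\<dots> \<le> dist_nearest_int ?y + \<bar>?x - ?y\<bar>"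
      by (rule dist_nearest_int_triangle)
    also have "?x - ?y = r' * (of_int (w i) + a * real (v i))"
      by (simp add: algebra_simps)
    also have "\<bar>\<dots>\<bar> \<le> 1 / 2 * (1 / real ?K)"
      unfolding abs_mult by (intro mult_mono r' bspec[OF close i]) auto
    also have "1 / 2 * (1 / real ?K) = 1 / (real n * real (n + 1))"
      using K by simp
    also have "\<dots> = 1 / real n - 1 / real (n + 1)"
      using \<open>n \<ge> 1\<close> by (simp add: field_simps)
    finally show ?thesis by simp
  qed
  then show "\<exists>t :: real. \<forall>i\<in>{1..n}. dist_nearest_int (real (v i) * t + s i) \<ge> 1 / real (n + 1)"
    by blast
qed

end
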